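(* Let $f_1:\mathbb{R}^m\to\mathbb{R}\cup\{+\infty\}$ be prox-bounded with threshold $r_1$, let $f_2:\mathbb{R}^n\to\mathbb{R}^m$ with $\operatorname{ran}f_2\subseteq\operatorname{dom}f_1$, where, in the case $m=1$, $f_2$ is prox-bounded with threshold $r_2$. Define $f=f_1\circ f_2$ and denote the threshold of prox-boundedness of $f$ by $\bar r$ when it exists. Then the following hold. (i) If $f_1$ and $f_2$ are (globally) Lipschitz continuous, then $\bar r=0$. (ii) If $m=1$ and $f_1$ is affine, $f_1(x)=ax+b$ with $a,b\in\mathbb{R}$ and $a\ge0$, then $\bar r=a\,r_2$. (iii) If $m=n$ and $f_2$ is affine of the form $f_2(x)=ax+b$ with $a\in\mathbb{R}$ and $b\in\mathbb{R}^n$, then $\bar r=a^2r_1$. (In each case the assertion includes that $f$ is prox-bounded.)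
   Context: $\mathbb{R}^n$ and $\mathbb{R}^m$ are equipped with inner products and the induced norms $\|\cdot\|$. For $f:\mathbb{R}^n\to\mathbb{R}\cup\{+\infty\}$ and $r\ge 0$, the Moreau envelope of $f$ is $e_rf(x)=\inf_{y\in\mathbb{R}^n}\{f(y)+\frac r2\|y-x\|^2\}$. The function $f$ is prox-bounded if there exists $r\ge0$ such that $e_rf(x)>-\infty$ for some $x\in\mathbb{R}^n$; the infimum of all such $r\ge 0$ is called the threshold of prox-boundedness of $f$. $\operatorname{dom}f_1=\{x:f_1(x)<+\infty\}$ and $\operatorname{ran}f_2$ is the range of $f_2$. A map $g$ is globally Lipschitz continuous if there is $K>0$ with $\|g(y)-g(x)\|\le K\|y-x\|$ for all $x,y$; a Lipschitz $f_1$ is in particular real-valued. When $m=n$ the two spaces carry the same inner product; when $m=1$, $\mathbb{R}$ carries the usual absolute value. *)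

theory Defs
  imports "HOL-Analysis.Analysis"
begin

text \<open>
  A space \<open>\<real>\<^sup>n\<close> with an inner product is a type of class \<open>euclidean_space\<close>. Functions into
  \<open>\<real> \<union> {+\<infinity>}\<close> are \<open>ereal\<close>-valued functions that avoid \<open>-\<infinity>\<close>; this is part of
  \<open>composition_setting\<close> below and not of the general definitions.
\<close>

definition moreau_envelope :: "real \<Rightarrow> ('a::euclidean_space \<Rightarrow> ereal) \<Rightarrow> 'a \<Rightarrow> ereal" where
  "moreau_envelope r f x = (INF y. f y + ereal (r / 2 * (norm (y - x))\<^sup>2))"

definition prox_bounded :: "('a::euclidean_space \<Rightarrow> ereal) \<Rightarrow> bool" where
  "prox_bounded f \<longleftrightarrow> (\<exists>r\<ge>0. \<exists>x. moreau_envelope r f x > -\<infinity>)"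

text \<open>Only meaningful when \<open>prox_bounded f\<close>: otherwise this is the infimum of the empty set.\<close>

definition prox_threshold :: "('a::euclidean_space \<Rightarrow> ereal) \<Rightarrow> real" where
  "prox_threshold f = Inf {r. r \<ge> 0 \<and> (\<exists>x. moreau_envelope r f x > -\<infinity>)}"

definition effective_domain :: "('a \<Rightarrow> ereal) \<Rightarrow> 'a set" where
  "effective_domain f = {x. f x < \<infinity>}"

definition globally_lipschitz :: "('a::metric_space \<Rightarrow> 'b::metric_space) \<Rightarrow> bool" where
  "globally_lipschitz g \<longleftrightarrow> (\<exists>K>0. K-lipschitz_on UNIV g)"

text \<open>
  The hypotheses common to all the statements about \<open>f\<^sub>1 \<circ> f\<^sub>2\<close>. If the codomain of \<open>f\<^sub>2\<close> is
  one-dimensional, \<open>Basis\<close> consists of a single unit vector \<open>u\<close>, and \<open>f\<^sub>2 x \<bullet> u\<close> is \<open>f\<^sub>2 x\<close> read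
  as a real number; for the type \<open>real\<close> itself \<open>u = 1\<close> and this is \<open>f\<^sub>2 x\<close>.
\<close>

definition composition_setting ::
  "('m::euclidean_space \<Rightarrow> ereal) \<Rightarrow> ('n::euclidean_space \<Rightarrow> 'm) \<Rightarrow> bool" where
  "composition_setting f\<^sub>1 f\<^sub>2 \<longleftrightarrow>
     (\<forall>x. f\<^sub>1 x \<noteq> -\<infinity>) \<and>
     prox_bounded f\<^sub>1 \<and>
     range f\<^sub>2 \<subseteq> effective_domain f\<^sub>1 \<and>
     (DIM('m) = 1 \<longrightarrow> (\<forall>u\<in>Basis. prox_bounded (\<lambda>x. ereal (f\<^sub>2 x \<bullet> u))))"

lemma composition_setting_real:
  fixes f\<^sub>1 :: "real \<Rightarrow> ereal" and f\<^sub>2 :: "'n::euclidean_space \<Rightarrow> real"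
  shows "composition_setting f\<^sub>1 f\<^sub>2 \<longleftrightarrow>
     (\<forall>x. f\<^sub>1 x \<noteq> -\<infinity>) \<and> prox_bounded f\<^sub>1 \<and> range f\<^sub>2 \<subseteq> effective_domain f\<^sub>1 \<and>
     prox_bounded (\<lambda>x. ereal (f\<^sub>2 x))"
  by (simp add: composition_setting_def)

end

theory Submission
  imports Defs
begin

text \<open>
  Prox-boundedness and its threshold depend only on the set of parameters \<open>r \<ge> 0\<close> for which some
  quadratic \<open>c - r/2 \<parallel>y - x\<parallel>\<^sup>2\<close> minorises the function, because \<open>e\<^sub>r f(x) > -\<infinity>\<close> for some \<open>x\<close> says exactly that
  such \<open>c\<close> and \<open>x\<close> exist. All three claims are computations of this set.

  A real-valued Lipschitz function decreases at most linearly, so any positive quadratic term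
  dominates the decrease: every \<open>r > 0\<close> is admissible and the threshold is \<open>0\<close>
  (\<open>lipschitz_imp_prox_threshold_zero\<close>). A composition of Lipschitz maps is Lipschitz, which gives
  the first claim; constant functions are Lipschitz too, which gives the other two when \<open>a = 0\<close>.

  If \<open>a \<noteq> 0\<close>, an affine change of the value (\<open>f = a f\<^sub>2 + b\<close>, \<open>a > 0\<close>) or of the
  argument (\<open>f(x) = f\<^sub>1(a x + b)\<close>) carries the quadratic minorants of \<open>f\<^sub>2\<close> or \<open>f\<^sub>1\<close>
  bijectively to those of \<open>f\<close>, multiplying the parameter by \<open>a\<close> or \<open>a\<^sup>2\<close> respectively. The admissible
  set, and with it its infimum, is scaled by that factor (\<open>prox_threshold_scale\<close>).
\<close>

definition prox_parameters :: "('a::euclidean_space \<Rightarrow> ereal) \<Rightarrow> real set" where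
  "prox_parameters f = {r. r \<ge> 0 \<and> (\<exists>x. moreau_envelope r f x > -\<infinity>)}"

lemma prox_bounded_iff_parameters: "prox_bounded f \<longleftrightarrow> prox_parameters f \<noteq> {}"
  by (auto simp: prox_bounded_def prox_parameters_def)

lemma prox_threshold_eq_Inf_parameters: "prox_threshold f = Inf (prox_parameters f)"
  by (simp add: prox_threshold_def prox_parameters_def)

text \<open>
  This trades the infimum in \<open>ereal\<close> for a bound by a real constant, so that the three
  claims need only real arithmetic. A value \<open>+\<infinity>\<close> of the envelope (\<open>f\<close> identically \<open>+\<infinity>\<close>)
  is covered: then every constant is a bound.
\<close>

lemma moreau_envelope_gt_MInfty_iff:
  "moreau_envelope r f x > -\<infinity> \<longleftrightarrow> (\<exists>c. \<forall>y. ereal c \<le> f y + ereal (r / 2 * (norm (y - x))\<^sup>2))"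
proof
  assume "moreau_envelope r f x > -\<infinity>"
  then obtain c where "ereal c < moreau_envelope r f x"
    using ereal_dense2 by blast
  then have "\<forall>y. ereal c \<le> f y + ereal (r / 2 * (norm (y - x))\<^sup>2)"
    unfolding moreau_envelope_def by (meson INF_lower UNIV_I less_imp_le order_trans)
  then show "\<exists>c. \<forall>y. ereal c \<le> f y + ereal (r / 2 * (norm (y - x))\<^sup>2)" by blast
next
  assume "\<exists>c. \<forall>y. ereal c \<le> f y + ereal (r / 2 * (norm (y - x))\<^sup>2)"
  then obtain c where "\<forall>y. ereal c \<le> f y + ereal (r / 2 * (norm (y - x))\<^sup>2)" by blast
  then have "ereal c \<le> moreau_envelope r f x"
    unfolding moreau_envelope_def by (simp add: INF_greatest)
  then show "moreau_envelope r f x > -\<infinity>"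
    by (metis MInfty_neq_ereal(1) ereal_infty_less(2) ereal_infty_less_eq(2))
qed

lemma prox_parameters_iff_minorant:
  "r \<in> prox_parameters f \<longleftrightarrow>
     r \<ge> 0 \<and> (\<exists>x c. \<forall>y. ereal c \<le> f y + ereal (r / 2 * (norm (y - x))\<^sup>2))"
  unfolding prox_parameters_def moreau_envelope_gt_MInfty_iff by blast

lemma prox_threshold_scale:
  fixes f :: "'a::euclidean_space \<Rightarrow> ereal" and g :: "'b::euclidean_space \<Rightarrow> ereal"
  assumes c: "c > 0" and g: "prox_bounded g"
    and scale: "\<And>r. c * r \<in> prox_parameters f \<longleftrightarrow> r \<in> prox_parameters g"
  shows "prox_bounded f \<and> prox_threshold f = c * prox_threshold g"
proof -
  have img: "prox_parameters f = (*) c ` prox_parameters g"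
  proof (intro set_eqI iffI)
    fix s assume "s \<in> prox_parameters f"
    then show "s \<in> (*) c ` prox_parameters g"
      using scale[of "s / c"] c by (intro image_eqI[of _ _ "s / c"]) auto
  qed (use scale in auto)
  have ne: "prox_parameters g \<noteq> {}"
    using g by (simp add: prox_bounded_iff_parameters)
  have bdd: "bdd_below (prox_parameters g)"
    by (rule bdd_belowI[of _ 0]) (simp add: prox_parameters_def)
  have "c * Inf (prox_parameters g) = Inf ((*) c ` prox_parameters g)"
    using c by (intro continuous_at_Inf_mono ne bdd monoI continuous_intros) simp
  then show ?thesis
    using img ne by (simp add: prox_bounded_iff_parameters prox_threshold_eq_Inf_parameters)
qed

text \<open>
  With \<open>L\<close> a Lipschitz constant and \<open>t\<close> the distance to the base point, the function plus the
  quadratic term is at least \<open>h(0) - L t + r t\<^sup>2 / 2\<close>, which completing the square bounds below by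
  \<open>h(0) - L\<^sup>2 / (2 r)\<close> for every \<open>r > 0\<close>. The parameter \<open>0\<close> itself may fail (a nonzero linear
  function), so the threshold need not be attained.
\<close>

lemma lipschitz_imp_prox_threshold_zero:
  fixes h :: "'a::euclidean_space \<Rightarrow> real"
  assumes "L-lipschitz_on UNIV h"
  shows "prox_bounded (\<lambda>x. ereal (h x)) \<and> prox_threshold (\<lambda>x. ereal (h x)) = 0"
proof -
  let ?P = "prox_parameters (\<lambda>x. ereal (h x))"
  have pos: "r \<in> ?P" if r: "r > 0" for r
  proof -
    have "h 0 - L\<^sup>2 / (2 * r) \<le> h y + r / 2 * (norm (y - 0))\<^sup>2" for y
    proof -
      have lip: "\<bar>h y - h 0\<bar> \<le> L * norm y"
        using lipschitz_onD[OF assms, of y 0] by (simp add: dist_norm)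
      have "0 \<le> (r * norm y - L)\<^sup>2 / (2 * r)" using r by simp
      also have "\<dots> = r / 2 * (norm y)\<^sup>2 - L * norm y + L\<^sup>2 / (2 * r)"
        using r by (simp add: field_simps power2_eq_square)
      finally show ?thesis using lip by simp
    qed
    then have "\<exists>x c. \<forall>y. ereal c \<le> ereal (h y) + ereal (r / 2 * (norm (y - x))\<^sup>2)"
      unfolding plus_ereal.simps ereal_less_eq by blast
    then show ?thesis using r by (simp add: prox_parameters_iff_minorant)
  qed
  have bdd: "bdd_below ?P"
    by (rule bdd_belowI[of _ 0]) (simp add: prox_parameters_def)
  have ne: "?P \<noteq> {}" using pos[of 1] by auto
  have "Inf ?P \<le> 0"
    by (rule field_le_epsilon) (use cInf_lower[OF pos bdd] in auto)
  moreover have "0 \<le> Inf ?P"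
    by (rule cInf_greatest[OF ne]) (simp add: prox_parameters_def)
  ultimately show ?thesis
    using ne by (simp add: prox_bounded_iff_parameters prox_threshold_eq_Inf_parameters)
qed

lemma prox_threshold_const:
  "prox_bounded (\<lambda>_::'a::euclidean_space. ereal k) \<and>
   prox_threshold (\<lambda>_::'a. ereal k) = 0"
  by (rule lipschitz_imp_prox_threshold_zero[of 0]) (rule lipschitz_on_constant)

text \<open>
  Multiplying a minorant by \<open>a\<close> multiplies both its constant and its curvature; the shift \<open>b\<close>
  is absorbed by the constant. Positivity of \<open>a\<close> makes this reversible, and it keeps the
  inequality pointing the same way.
\<close>

lemma prox_parameters_affine_value:
  fixes h :: "'a::euclidean_space \<Rightarrow> real"
  assumes a: "a > 0"
  shows "a * r \<in> prox_parameters (\<lambda>x. ereal (a * h x + b)) \<longleftrightarrow>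
         r \<in> prox_parameters (\<lambda>x. ereal (h x))"
proof -
  have bound: "a * c + b \<le> a * h y + b + a * r / 2 * (norm (y - x))\<^sup>2 \<longleftrightarrow>
               c \<le> h y + r / 2 * (norm (y - x))\<^sup>2" for c x y
  proof -
    have "a * h y + b + a * r / 2 * (norm (y - x))\<^sup>2 = a * (h y + r / 2 * (norm (y - x))\<^sup>2) + b"
      by (simp add: algebra_simps)
    then show ?thesis using a by simp
  qed
  have "(\<exists>x c. \<forall>y. c \<le> a * h y + b + a * r / 2 * (norm (y - x))\<^sup>2) \<longleftrightarrow>
        (\<exists>x c. \<forall>y. c \<le> h y + r / 2 * (norm (y - x))\<^sup>2)"
  proof
    assume "\<exists>x c. \<forall>y. c \<le> a * h y + b + a * r / 2 * (norm (y - x))\<^sup>2"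
    then obtain x c where "\<forall>y. c \<le> a * h y + b + a * r / 2 * (norm (y - x))\<^sup>2" by blast
    moreover have "c = a * ((c - b) / a) + b" using a by simp
    ultimately have "\<forall>y. (c - b) / a \<le> h y + r / 2 * (norm (y - x))\<^sup>2"
      using bound by metis
    then show "\<exists>x c. \<forall>y. c \<le> h y + r / 2 * (norm (y - x))\<^sup>2" by blast
  next
    assume "\<exists>x c. \<forall>y. c \<le> h y + r / 2 * (norm (y - x))\<^sup>2"
    then show "\<exists>x c. \<forall>y. c \<le> a * h y + b + a * r / 2 * (norm (y - x))\<^sup>2"
      using bound by blast
  qed
  moreover have "0 \<le> a * r \<longleftrightarrow> 0 \<le> r" using a by (simp add: zero_le_mult_iff)
  ultimately show ?thesis by (simp add: prox_parameters_iff_minorant)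
qed

text \<open>
  The map \<open>y \<mapsto> a y + b\<close> is a bijection that stretches distances by \<open>\<bar>a\<bar>\<close>. A minorant of
  \<open>g\<close> centred at the image of \<open>x\<close> therefore pulls back to one centred at \<open>x\<close>, with the same constant
  and with curvature multiplied by \<open>a\<^sup>2\<close>.
\<close>

lemma prox_parameters_affine_argument:
  fixes g :: "'a::euclidean_space \<Rightarrow> ereal"
  assumes a: "a \<noteq> 0"
  shows "a\<^sup>2 * r \<in> prox_parameters (\<lambda>x. g (a *\<^sub>R x + b)) \<longleftrightarrow> r \<in> prox_parameters g"
proof -
  let ?T = "\<lambda>x. a *\<^sub>R x + b"
  have stretch: "a\<^sup>2 * r / 2 * (norm (y - x))\<^sup>2 = r / 2 * (norm (?T y - ?T x))\<^sup>2" for x y :: 'a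
  proof -
    have "?T y - ?T x = a *\<^sub>R (y - x)" by (simp add: scaleR_diff_right)
    then show ?thesis by (simp add: power_mult_distrib)
  qed
  have "surj ?T"
  proof (rule surjI)
    show "?T (inverse a *\<^sub>R (z - b)) = z" for z using a by simp
  qed
  then have onto: "(\<exists>x. P (?T x)) \<longleftrightarrow> (\<exists>z. P z)" "(\<forall>y. P (?T y)) \<longleftrightarrow> (\<forall>z. P z)" for P
    unfolding surj_def by metis+
  have "(\<exists>x c. \<forall>y. ereal c \<le> g (?T y) + ereal (a\<^sup>2 * r / 2 * (norm (y - x))\<^sup>2)) \<longleftrightarrow>
        (\<exists>x c. \<forall>y. ereal c \<le> g (?T y) + ereal (r / 2 * (norm (?T y - ?T x))\<^sup>2))"
    by (simp only: stretch)
  also have "\<dots> \<longleftrightarrow> (\<exists>x c. \<forall>z. ereal c \<le> g z + ereal (r / 2 * (norm (z - ?T x))\<^sup>2))"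
    by (subst onto(2)) (rule refl)
  also have "\<dots> \<longleftrightarrow> (\<exists>w c. \<forall>z. ereal c \<le> g z + ereal (r / 2 * (norm (z - w))\<^sup>2))"
    by (rule onto(1))
  finally show ?thesis
    using a by (simp add: prox_parameters_iff_minorant zero_le_mult_iff)
qed

theorem proposition4p16:
  shows "(\<forall>(f\<^sub>1 :: 'm::euclidean_space \<Rightarrow> ereal) (f\<^sub>2 :: 'n::euclidean_space \<Rightarrow> 'm).
            composition_setting f\<^sub>1 f\<^sub>2 \<longrightarrow>
            (\<exists>g. f\<^sub>1 = (\<lambda>x. ereal (g x)) \<and> globally_lipschitz g) \<longrightarrow>
            globally_lipschitz f\<^sub>2 \<longrightarrow>
            prox_bounded (f\<^sub>1 \<circ> f\<^sub>2) \<and> prox_threshold (f\<^sub>1 \<circ> f\<^sub>2) = 0) \<and>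
         (\<forall>(f\<^sub>1 :: real \<Rightarrow> ereal) (f\<^sub>2 :: 'n \<Rightarrow> real) (a :: real) (b :: real).
            composition_setting f\<^sub>1 f\<^sub>2 \<longrightarrow>
            a \<ge> 0 \<longrightarrow>
            (\<forall>x. f\<^sub>1 x = ereal (a * x + b)) \<longrightarrow>
            prox_bounded (f\<^sub>1 \<circ> f\<^sub>2) \<and>
            prox_threshold (f\<^sub>1 \<circ> f\<^sub>2) = a * prox_threshold (\<lambda>x. ereal (f\<^sub>2 x))) \<and>
         (\<forall>(f\<^sub>1 :: 'n \<Rightarrow> ereal) (f\<^sub>2 :: 'n \<Rightarrow> 'n) (a :: real) (b :: 'n).
            composition_setting f\<^sub>1 f\<^sub>2 \<longrightarrow>
            (\<forall>x. f\<^sub>2 x = a *\<^sub>R x + b) \<longrightarrow>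
            prox_bounded (f\<^sub>1 \<circ> f\<^sub>2) \<and>
            prox_threshold (f\<^sub>1 \<circ> f\<^sub>2) = a\<^sup>2 * prox_threshold f\<^sub>1)"
proof (rule conjI[OF _ conjI]; intro allI impI)
  fix f\<^sub>1 :: "'m \<Rightarrow> ereal" and f\<^sub>2 :: "'n \<Rightarrow> 'm"
  assume "\<exists>g. f\<^sub>1 = (\<lambda>x. ereal (g x)) \<and> globally_lipschitz g" and "globally_lipschitz f\<^sub>2"
  then obtain g K L where f1: "f\<^sub>1 = (\<lambda>x. ereal (g x))"
    and g: "K-lipschitz_on UNIV g" and f2: "L-lipschitz_on UNIV f\<^sub>2"
    unfolding globally_lipschitz_def by blast
  have "(K * L)-lipschitz_on UNIV (\<lambda>x. g (f\<^sub>2 x))"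
    using f2 lipschitz_on_subset[OF g] by (rule lipschitz_on_compose2) simp
  from lipschitz_imp_prox_threshold_zero[OF this]
  show "prox_bounded (f\<^sub>1 \<circ> f\<^sub>2) \<and> prox_threshold (f\<^sub>1 \<circ> f\<^sub>2) = 0"
    by (simp add: f1 comp_def)
next
  fix f\<^sub>1 :: "real \<Rightarrow> ereal" and f\<^sub>2 :: "'n \<Rightarrow> real" and a b :: real
  assume setting: "composition_setting f\<^sub>1 f\<^sub>2" and a: "a \<ge> 0"
    and f1: "\<forall>x. f\<^sub>1 x = ereal (a * x + b)"
  have f: "f\<^sub>1 \<circ> f\<^sub>2 = (\<lambda>x. ereal (a * f\<^sub>2 x + b))" using f1 by (simp add: comp_def)
  show "prox_bounded (f\<^sub>1 \<circ> f\<^sub>2) \<and>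
        prox_threshold (f\<^sub>1 \<circ> f\<^sub>2) = a * prox_threshold (\<lambda>x. ereal (f\<^sub>2 x))"
  proof (cases "a = 0")
    case True
    then show ?thesis using prox_threshold_const[of b] by (simp add: f)
  next
    case False
    then have pos: "a > 0" using a by simp
    have "prox_bounded (\<lambda>x. ereal (f\<^sub>2 x))"
      using setting by (simp add: composition_setting_real)
    then show ?thesis
      unfolding f using prox_parameters_affine_value[OF pos]
      by (rule prox_threshold_scale[OF pos])
  qed
next
  fix f\<^sub>1 :: "'n \<Rightarrow> ereal" and f\<^sub>2 :: "'n \<Rightarrow> 'n" and a :: real and b :: 'n
  assume setting: "composition_setting f\<^sub>1 f\<^sub>2" and f2: "\<forall>x. f\<^sub>2 x = a *\<^sub>R x + b"
  have f: "f\<^sub>1 \<circ> f\<^sub>2 = (\<lambda>x. f\<^sub>1 (a *\<^sub>R x + b))" using f2 by (simp add: comp_def)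
  show "prox_bounded (f\<^sub>1 \<circ> f\<^sub>2) \<and> prox_threshold (f\<^sub>1 \<circ> f\<^sub>2) = a\<^sup>2 * prox_threshold f\<^sub>1"
  proof (cases "a = 0")
    case True
    \<comment> \<open>The composition is the constant \<open>f\<^sub>1 b\<close>, which is real because \<open>b\<close>, a value of \<open>f\<^sub>2\<close>,
      lies in the effective domain.\<close>
    have "f\<^sub>2 0 = b" using f2 by simp
    then have "f\<^sub>1 b < \<infinity>" and "f\<^sub>1 b \<noteq> -\<infinity>"
      using setting by (auto simp: composition_setting_def effective_domain_def)
    then obtain k where "f\<^sub>1 b = ereal k" by (cases "f\<^sub>1 b") auto
    then show ?thesis using True prox_threshold_const[of k] by (simp add: f)
  next
    case False
    have "prox_bounded f\<^sub>1" using setting by (simp add: composition_setting_def)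
    moreover have "a\<^sup>2 > 0" using False by simp
    ultimately show ?thesis
      unfolding f using prox_parameters_affine_argument[OF False]
      by (intro prox_threshold_scale)
  qed
qed

end
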